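(* Let $E$ and $F$ be Dedekind complete Riesz spaces with weak order units $e$ and $f$ respectively. (a) If $p\in C_E(e)$ and $q\in C_F(f)$, then $p\otimes q\in C_{\overline{E\overline{\otimes}F}^{\delta}}(e\otimes f)$. (b) If $u\in C_{\overline{E\overline{\otimes}F}^{\delta}}(e\otimes f)$, then $$u=\sup\{p\otimes q : p\in C_E(e),\ q\in C_F(f),\ p\otimes q\le u\},$$ the supremum taken in $\overline{E\overline{\otimes}F}^{\delta}$.
   Context: For a Riesz space $G$ with weak order unit $w$, a component of $w$ is an element $p$ with $0\le p\le w$ and $(w-p)\wedge p=0$; $C_G(w)$ denotes the set of components of $w$ in $G$. $\overline{E\overline{\otimes}F}^{\delta}$ denotes the Dedekind completion of the Fremlin tensor product $E\overline{\otimes}F$ of $E$ and $F$ (ordered by the cone generated by $E_+\otimes F_+$); $e\otimes f$ is a weak order unit of it. *)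

theory Defs
  imports Main "HOL-Library.Lub_Glb"
begin

text \<open>Riesz spaces are modelled by the type-class combination
  ordered_real_vector + lattice; Dedekind complete ones additionally by
  conditionally_complete_lattice (every nonempty bounded-above set has a supremum).\<close>

definition rabs :: "'a::{ordered_real_vector, lattice} \<Rightarrow> 'a" where
  "rabs x = sup x (- x)"

definition weak_order_unit :: "'a::{ordered_real_vector, lattice} \<Rightarrow> bool" where
  "weak_order_unit w \<longleftrightarrow> 0 \<le> w \<and> (\<forall>x. inf (rabs x) w = 0 \<longrightarrow> x = 0)"

definition components :: "'a::{ordered_real_vector, lattice} \<Rightarrow> 'a set" where
  "components w = {p. 0 \<le> p \<and> p \<le> w \<and> inf (w - p) p = 0}"

definition is_sup :: "'a::order \<Rightarrow> 'a set \<Rightarrow> bool" where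
  "is_sup z S \<longleftrightarrow> (\<forall>s\<in>S. s \<le> z) \<and> (\<forall>b. (\<forall>s\<in>S. s \<le> b) \<longrightarrow> z \<le> b)"

definition is_inf :: "'a::order \<Rightarrow> 'a set \<Rightarrow> bool" where
  "is_inf z S \<longleftrightarrow> (\<forall>s\<in>S. z \<le> s) \<and> (\<forall>b. (\<forall>s\<in>S. b \<le> s) \<longrightarrow> b \<le> z)"

text \<open>The free vector lattice over a set S is the vector sublattice of
  real^(real^S) generated by the evaluation maps.\<close>

definition ev :: "'s \<Rightarrow> (('s \<Rightarrow> real) \<Rightarrow> real)" where
  "ev s = (\<lambda>\<omega>. \<omega> s)"

inductive_set fvl :: "(('s \<Rightarrow> real) \<Rightarrow> real) set" where
  fvl_ev: "ev s \<in> fvl"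
| fvl_add: "g \<in> fvl \<Longrightarrow> h \<in> fvl \<Longrightarrow> (\<lambda>\<omega>. g \<omega> + h \<omega>) \<in> fvl"
| fvl_scale: "g \<in> fvl \<Longrightarrow> (\<lambda>\<omega>. c * g \<omega>) \<in> fvl"
| fvl_max: "g \<in> fvl \<Longrightarrow> h \<in> fvl \<Longrightarrow> (\<lambda>\<omega>. max (g \<omega>) (h \<omega>)) \<in> fvl"

text \<open>Relations forcing (x,y) \<mapsto> x \<otimes> y to be a bilinear Riesz bimorphism
  (a bilinear map \<phi> is a Riesz bimorphism iff |\<phi>(x,y)| = \<phi>(|x|,|y|)).\<close>

definition tensor_relations ::
  "(('a::{ordered_real_vector,lattice} \<times> 'b::{ordered_real_vector,lattice} \<Rightarrow> real) \<Rightarrow> real) set" where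
  "tensor_relations =
     {(\<lambda>\<omega>. ev (x + x', y) \<omega> - ev (x, y) \<omega> - ev (x', y) \<omega>) | x x' y. True}
   \<union> {(\<lambda>\<omega>. ev (x, y + y') \<omega> - ev (x, y) \<omega> - ev (x, y') \<omega>) | x y y'. True}
   \<union> {(\<lambda>\<omega>. ev (c *\<^sub>R x, y) \<omega> - c * ev (x, y) \<omega>) | c x y. True}
   \<union> {(\<lambda>\<omega>. ev (x, c *\<^sub>R y) \<omega> - c * ev (x, y) \<omega>) | c x y. True}
   \<union> {(\<lambda>\<omega>. \<bar>ev (x, y) \<omega>\<bar> - ev (rabs x, rabs y) \<omega>) | x y. True}"

definition fvl_ideal :: "(('s \<Rightarrow> real) \<Rightarrow> real) set \<Rightarrow> bool" where
  "fvl_ideal I \<longleftrightarrow> I \<subseteq> fvl \<and> (\<lambda>\<omega>. 0) \<in> I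
     \<and> (\<forall>g\<in>I. \<forall>h\<in>I. (\<lambda>\<omega>. g \<omega> + h \<omega>) \<in> I)
     \<and> (\<forall>g\<in>I. \<forall>c. (\<lambda>\<omega>. c * g \<omega>) \<in> I)
     \<and> (\<forall>g\<in>fvl. \<forall>h\<in>I. (\<forall>\<omega>. \<bar>g \<omega>\<bar> \<le> \<bar>h \<omega>\<bar>) \<longrightarrow> g \<in> I)"

definition uniformly_closed :: "(('s \<Rightarrow> real) \<Rightarrow> real) set \<Rightarrow> bool" where
  "uniformly_closed I \<longleftrightarrow>
     (\<forall>g\<in>fvl. \<forall>u\<in>fvl.
        (\<forall>n::nat. \<exists>h\<in>I. \<forall>\<omega>. \<bar>g \<omega> - h \<omega>\<bar> \<le> u \<omega> / real (Suc n)) \<longrightarrow> g \<in> I)"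

definition tensor_kernel ::
  "(('a::{ordered_real_vector,lattice} \<times> 'b::{ordered_real_vector,lattice} \<Rightarrow> real) \<Rightarrow> real) set" where
  "tensor_kernel = \<Inter>{I. fvl_ideal I \<and> uniformly_closed I \<and> tensor_relations \<subseteq> I}"

text \<open>The Fremlin tensor product is fvl / tensor_kernel (the Archimedean Riesz space
  satisfying Fremlin's universal property). A Dedekind completion of it is a Dedekind
  complete Riesz space G together with a Riesz homomorphism J: fvl \<rightarrow> G whose kernel is
  tensor_kernel (so J embeds the quotient) and whose image is order dense and majorizing
  in the sense that every element of G is both the supremum and the infimum of image
  elements below/above it.\<close>

definition fremlin_completion ::
  "((('a::{ordered_real_vector,lattice} \<times> 'b::{ordered_real_vector,lattice} \<Rightarrow> real) \<Rightarrow> real)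
     \<Rightarrow> 'c::{ordered_real_vector, conditionally_complete_lattice}) \<Rightarrow> bool" where
  "fremlin_completion J \<longleftrightarrow>
     (\<forall>g\<in>fvl. \<forall>h\<in>fvl. J (\<lambda>\<omega>. g \<omega> + h \<omega>) = J g + J h)
   \<and> (\<forall>g\<in>fvl. \<forall>c. J (\<lambda>\<omega>. c * g \<omega>) = c *\<^sub>R J g)
   \<and> (\<forall>g\<in>fvl. \<forall>h\<in>fvl. J (\<lambda>\<omega>. max (g \<omega>) (h \<omega>)) = sup (J g) (J h))
   \<and> {g\<in>fvl. J g = 0} = tensor_kernel
   \<and> (\<forall>z. is_sup z {J g | g. g \<in> fvl \<and> J g \<le> z} \<and> is_inf z {J g | g. g \<in> fvl \<and> z \<le> J g})"

end

theory Submission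
  imports Defs "HOL-Library.Lattice_Algebras"
begin

text \<open>Part (a) only uses that $(x, y) \mapsto x \otimes y$ is a Riesz bimorphism. For (b), if an
  upper bound \<open>b\<close> fails to dominate \<open>u\<close>, then $w = u - u \wedge b > 0$, and it suffices to
  find components with $p \otimes q \neq 0$ and $c\, p \otimes q \le w$ for some $c > 0$: such a
  tensor $t = p \otimes q$ lies below \<open>u\<close>, hence below \<open>b\<close>, so $c\,t \le w \le u - t$ is disjoint
  from \<open>t\<close>.

  Some $J g \not\le 0$ lies below \<open>w\<close>. As \<open>g\<close> is a lattice-linear expression in finitely
  many $x_i \otimes y_i$, cutting large positive elements $x_1$, $y_1$ into pieces on which every
  $x_i$, $y_i$ is nearly a constant multiple of $x_1$, $y_1$ makes $J g$ nearly a constant multiple of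
  $x_1 \otimes y_1$ on each tensor of pieces, and on one of them the constant is positive. This
  gives $0 \neq x \otimes y \le w$; truncating by \<open>e\<close> and \<open>f\<close> and passing to the components
  generated by $(x - \alpha e)^+$ and $(y - \beta f)^+$ completes the argument.\<close>

section \<open>Riesz space arithmetic\<close>

interpretation riesz: lattice_ab_group_add
  "(+) :: 'a::{ordered_real_vector, lattice} \<Rightarrow> 'a \<Rightarrow> 'a" 0 "(-)" uminus "(\<le>)" "(<)" inf sup
  by unfold_locales

abbreviation pos_part :: "'a::{ordered_real_vector, lattice} \<Rightarrow> 'a" where
  "pos_part x \<equiv> sup x 0"

lemma scaleR_inf:
  fixes a b :: "'a::{ordered_real_vector, lattice}"
  assumes "0 \<le> k"
  shows "k *\<^sub>R inf a b = inf (k *\<^sub>R a) (k *\<^sub>R b)"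
proof (cases "k = 0")
  case False
  with assms have k: "0 < k" by simp
  show ?thesis
  proof (rule antisym)
    show "k *\<^sub>R inf a b \<le> inf (k *\<^sub>R a) (k *\<^sub>R b)"
      using assms by (simp add: scaleR_left_mono)
    have "inverse k *\<^sub>R inf (k *\<^sub>R a) (k *\<^sub>R b) \<le> inverse k *\<^sub>R (k *\<^sub>R a)"
      "inverse k *\<^sub>R inf (k *\<^sub>R a) (k *\<^sub>R b) \<le> inverse k *\<^sub>R (k *\<^sub>R b)"
      using assms by (intro scaleR_left_mono; simp)+
    then have "inverse k *\<^sub>R inf (k *\<^sub>R a) (k *\<^sub>R b) \<le> inf a b"
      using False by simp
    then have "k *\<^sub>R (inverse k *\<^sub>R inf (k *\<^sub>R a) (k *\<^sub>R b)) \<le> k *\<^sub>R inf a b"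
      using assms by (intro scaleR_left_mono)
    then show "inf (k *\<^sub>R a) (k *\<^sub>R b) \<le> k *\<^sub>R inf a b"
      using k by simp
  qed
qed simp

lemma scaleR_sup:
  fixes a b :: "'a::{ordered_real_vector, lattice}"
  assumes "0 \<le> k"
  shows "k *\<^sub>R sup a b = sup (k *\<^sub>R a) (k *\<^sub>R b)"
proof -
  have "k *\<^sub>R sup a b = - (k *\<^sub>R inf (- a) (- b))"
    by (simp flip: scaleR_minus_right)
  also have "\<dots> = sup (k *\<^sub>R a) (k *\<^sub>R b)"
    by (simp add: scaleR_inf[OF assms])
  finally show ?thesis .
qed

text \<open>Distributing the sum on the right over both infima gives the infimum of
  \<open>a + a\<close>, \<open>b + a\<close>, \<open>a + c\<close> and \<open>b + c\<close>;
  positivity puts each of these above \<open>inf a (b + c)\<close>.\<close>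

lemma inf_add_le:
  fixes a b c :: "'a::{ordered_real_vector, lattice}"
  assumes "0 \<le> a" "0 \<le> b" "0 \<le> c"
  shows "inf a (b + c) \<le> inf a b + inf a c"
proof -
  have "inf a b + inf a c = inf (inf (a + a) (b + a)) (inf (a + c) (b + c))"
    by (simp add: riesz.add_inf_distrib_left riesz.add_inf_distrib_right)
  moreover have "inf a (b + c) \<le> a + a" "inf a (b + c) \<le> b + a" "inf a (b + c) \<le> a + c"
    "inf a (b + c) \<le> b + c"
    using assms by (auto intro: le_infI1 simp: add_increasing)
  ultimately show ?thesis by simp
qed

lemma disjoint_mono:
  fixes a b :: "'a::{ordered_real_vector, lattice}"
  assumes "inf a b = 0" "0 \<le> a'" "a' \<le> a" "0 \<le> b'" "b' \<le> b"
  shows "inf a' b' = 0"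
  using inf_mono[OF assms(3,5)] assms by (simp add: order_antisym)

lemma disjoint_add:
  fixes a b c :: "'a::{ordered_real_vector, lattice}"
  assumes "inf b a = 0" "inf c a = 0" "0 \<le> a" "0 \<le> b" "0 \<le> c"
  shows "inf (b + c) a = 0"
  using inf_add_le[OF assms(3-5)] assms
  by (intro antisym) (auto simp: inf_commute)

text \<open>Scaling both elements by \<open>max c 1\<close> preserves disjointness, and this factor
  is large enough to shrink back to \<open>c *\<^sub>R a\<close> and \<open>b\<close>.\<close>

lemma disjoint_scaleR:
  fixes a b :: "'a::{ordered_real_vector, lattice}"
  assumes "inf a b = 0" "0 \<le> a" "0 \<le> b" "0 \<le> c"
  shows "inf (c *\<^sub>R a) b = 0"
proof -
  define k where "k = max c 1"
  have "inf (k *\<^sub>R a) (k *\<^sub>R b) = 0"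
    using scaleR_inf[of k a b] assms by (simp add: k_def)
  moreover have "b \<le> k *\<^sub>R b" "c *\<^sub>R a \<le> k *\<^sub>R a"
    using scaleR_right_mono[of 1 k b] scaleR_right_mono[of c k a] assms by (auto simp: k_def)
  ultimately show ?thesis
    using assms by (elim disjoint_mono) (auto intro: scaleR_nonneg_nonneg)
qed

lemma le_of_le_add_disjoint:
  fixes t x c :: "'a::{ordered_real_vector, lattice}"
  assumes "t \<le> x + c" "inf t c = 0" "0 \<le> t" "0 \<le> x" "0 \<le> c"
  shows "t \<le> x"
proof -
  have "t = inf t (x + c)" using assms by (simp add: inf_absorb1)
  also have "\<dots> \<le> inf t x + inf t c" by (rule inf_add_le) (use assms in auto)
  also have "\<dots> \<le> x" using assms by simp
  finally show ?thesis .
qed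

lemma disjoint_pos_part_minus:
  fixes a b :: "'a::{ordered_real_vector, lattice}"
  shows "inf (pos_part (a - b)) (pos_part (b - a)) = 0"
proof -
  have "pos_part (a - b) = a - inf a b" "pos_part (b - a) = b - inf a b"
    by (simp_all add: riesz.diff_inf_eq_sup sup_commute
        diff_conv_add_uminus riesz.add_sup_distrib_left del: add_uminus_conv_diff)
  moreover have "inf (a - inf a b) (b - inf a b) = 0"
    using riesz.add_inf_distrib_right[of a b "- inf a b"] by (simp del: riesz.neg_inf_eq_sup)
  ultimately show ?thesis by simp
qed

lemma pos_part_add_le:
  fixes a b :: "'a::{ordered_real_vector, lattice}"
  shows "pos_part (a + b) \<le> pos_part a + pos_part b"
  by (simp add: add_mono)

text \<open>Taking t = 1/(n+1) bounds all multiples (n+1) x by \<open>u\<close>. Their supremum s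
  then exists by completeness, and shifting the index gives s \<le> s - x.\<close>

lemma archimedean:
  fixes x u :: "'a::{ordered_real_vector, conditionally_complete_lattice}"
  assumes "\<And>t::real. 0 < t \<Longrightarrow> x \<le> t *\<^sub>R u"
  shows "x \<le> 0"
proof -
  let ?S = "range (\<lambda>n::nat. real (Suc n) *\<^sub>R x)"
  have "real (Suc n) *\<^sub>R x \<le> u" for n
    using scaleR_left_mono[OF assms[of "inverse (real (Suc n))"], of "real (Suc n)"] by simp
  then have bdd: "bdd_above ?S" by (auto intro!: bdd_aboveI)
  have "real (Suc n) *\<^sub>R x \<le> Sup ?S - x" for n
  proof -
    have "real (Suc (Suc n)) *\<^sub>R x \<le> Sup ?S"
      using bdd by (intro cSup_upper rangeI)
    moreover have "real (Suc (Suc n)) *\<^sub>R x = real (Suc n) *\<^sub>R x + x"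
      by (subst of_nat_Suc) (simp add: scaleR_add_left del: of_nat_Suc)
    ultimately show ?thesis by (simp only: le_diff_eq)
  qed
  then have "Sup ?S \<le> Sup ?S - x" by (intro cSup_least) auto
  then show ?thesis by simp
qed

section \<open>Inequalities on the band of an element\<close>

text \<open>\<open>le_on d a b\<close> says $a \le b$ in the band generated by \<open>d\<close>, phrased without band projections.\<close>

definition le_on :: "'a::{ordered_real_vector, lattice} \<Rightarrow> 'a \<Rightarrow> 'a \<Rightarrow> bool" where
  "le_on d a b \<longleftrightarrow> inf (pos_part (a - b)) d = 0"

lemma le_on_if_le: "0 \<le> d \<Longrightarrow> a \<le> b \<Longrightarrow> le_on d a b"
  by (simp add: le_on_def sup_absorb2 inf_absorb1)

lemma le_on_mono: "le_on d a b \<Longrightarrow> 0 \<le> d' \<Longrightarrow> d' \<le> d \<Longrightarrow> le_on d' a b"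
  unfolding le_on_def by (erule disjoint_mono) auto

text \<open>Only the difference of the two sides matters, so terms may be moved across or cancelled
  as in an ordinary inequality.\<close>

lemma le_on_cong_diff:
  assumes "le_on d a b" "a - b = a' - b'"
  shows "le_on d a' b'"
  using assms(1) unfolding le_on_def assms(2) .

lemma le_on_pos_part: "le_on (pos_part (b - a)) a b"
  by (simp add: le_on_def disjoint_pos_part_minus)

lemma le_on_add:
  assumes "le_on d a b" "le_on d a' b'" "0 \<le> d"
  shows "le_on d (a + a') (b + b')"
proof -
  have "inf (pos_part (a - b) + pos_part (a' - b')) d = 0"
    using assms by (intro disjoint_add) (auto simp: le_on_def)
  then show ?thesis
    unfolding le_on_def using assms pos_part_add_le[of "a - b" "a' - b'"]
    by (elim disjoint_mono) (auto simp: algebra_simps)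
qed

lemma le_on_trans:
  assumes "le_on d a b" "le_on d b c" "0 \<le> d"
  shows "le_on d a c"
  using le_on_add[OF assms] by (rule le_on_cong_diff) simp

lemma le_on_scaleR:
  assumes "le_on d a b" "0 \<le> d" "0 \<le> c"
  shows "le_on d (c *\<^sub>R a) (c *\<^sub>R b)"
proof -
  have "inf (c *\<^sub>R pos_part (a - b)) d = 0"
    using assms by (intro disjoint_scaleR) (auto simp: le_on_def)
  then show ?thesis
    using scaleR_sup[OF assms(3), of "a - b" 0] by (simp add: le_on_def scaleR_diff_right)
qed

lemma le_on_sup:
  assumes "le_on d a c" "le_on d b c" "0 \<le> d"
  shows "le_on d (sup a b) c"
proof -
  have "inf (pos_part (a - c) + pos_part (b - c)) d = 0"
    using assms by (intro disjoint_add) (auto simp: le_on_def)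
  moreover have "sup a b - c \<le> pos_part (a - c) + pos_part (b - c)"
  proof -
    have "a - c \<le> pos_part (a - c) + pos_part (b - c)" "b - c \<le> pos_part (a - c) + pos_part (b - c)"
      by (auto intro: add_increasing add_increasing2)
    then have "a \<le> pos_part (a - c) + pos_part (b - c) + c" "b \<le> pos_part (a - c) + pos_part (b - c) + c"
      by (auto simp only: diff_le_eq)
    then show ?thesis by (simp only: diff_le_eq le_sup_iff) 
  qed
  ultimately show ?thesis
    unfolding le_on_def using assms by (elim disjoint_mono) auto
qed

section \<open>Riesz bimorphisms\<close>

locale riesz_bimorphism =
  fixes T :: "'a::{ordered_real_vector, lattice} \<Rightarrow> 'b::{ordered_real_vector, lattice}
    \<Rightarrow> 'c::{ordered_real_vector, lattice}"
  assumes add_left: "T (x + x') y = T x y + T x' y"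
    and add_right: "T x (y + y') = T x y + T x y'"
    and scaleR_left: "T (c *\<^sub>R x) y = c *\<^sub>R T x y"
    and scaleR_right: "T x (c *\<^sub>R y) = c *\<^sub>R T x y"
    and rabs_eq: "rabs (T x y) = T (rabs x) (rabs y)"

section \<open>Absolute values\<close>

lemma rabs_of_nonneg: "0 \<le> x \<Longrightarrow> rabs x = x"
  by (metis neg_le_0_iff_le order_trans rabs_def sup_absorb1)

lemma rabs_ge: "x \<le> rabs x" "- x \<le> rabs x"
  by (simp_all add: rabs_def)

lemma rabs_nonneg: "0 \<le> rabs x"
proof -
  have "0 \<le> (1 / 2) *\<^sub>R (rabs x + rabs x)"
    using add_mono[OF rabs_ge(1) rabs_ge(2), of x x] by (intro scaleR_nonneg_nonneg) auto
  then show ?thesis by (simp flip: scaleR_2)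
qed

lemma rabs_triangle: "rabs (a + b) \<le> rabs a + rabs b"
proof -
  have "- (a + b) = - a + - b" by simp
  then show ?thesis
    unfolding rabs_def[of "a + b"] by (metis add_mono rabs_ge le_supI)
qed

lemma rabs_scaleR: "rabs (c *\<^sub>R x) = \<bar>c\<bar> *\<^sub>R rabs x"
proof (cases "0 \<le> c")
  case False
  then show ?thesis using scaleR_sup[of "- c" x "- x"] by (simp add: rabs_def sup_commute)
qed (simp add: rabs_def scaleR_sup)

text \<open>Infima become expressible through sums and one absolute value, which is the only lattice
  operation that a bimorphism preserves by definition.\<close>

lemma two_inf_eq:
  fixes a b :: "'a::{ordered_real_vector, lattice}"
  shows "2 *\<^sub>R inf a b = a + b - rabs (a - b)"
proof -
  have "a + b - rabs (a - b) = a + b + inf (b - a) (a - b)"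
    by (simp add: rabs_def riesz.diff_sup_eq_inf diff_conv_add_uminus del: add_uminus_conv_diff)
  also have "\<dots> = inf (b + b) (a + a)"
    by (simp add: riesz.add_inf_distrib_left)
  also have "\<dots> = 2 *\<^sub>R inf a b"
    using scaleR_inf[of 2 a b] by (simp only: scaleR_2 inf_commute)
  finally show ?thesis by simp
qed

context riesz_bimorphism
begin

text \<open>Transfers every result about the left variable to the right one.\<close>

lemma flip: "riesz_bimorphism (\<lambda>x y. T y x)"
  by unfold_locales (simp_all add: add_left add_right scaleR_left scaleR_right rabs_eq)

lemma zero_left [simp]: "T 0 y = 0"
  using scaleR_left[of 0 0 y] by simp

lemma minus_left: "T (- x) y = - T x y"
  using scaleR_left[of "-1" x y] by simp

lemma minus_right: "T x (- y) = - T x y"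
  using scaleR_right[of x "-1" y] by simp

lemma diff_left: "T (x - x') y = T x y - T x' y"
  using add_left[of x "- x'" y] by (simp add: minus_left)

lemma diff_right: "T x (y - y') = T x y - T x y'"
  using add_right[of x y "- y'"] by (simp add: minus_right)

lemma nonneg: "0 \<le> x \<Longrightarrow> 0 \<le> y \<Longrightarrow> 0 \<le> T x y"
  using rabs_eq[of x y] rabs_nonneg[of "T x y"] by (simp add: rabs_of_nonneg)

lemma mono_left: "x \<le> x' \<Longrightarrow> 0 \<le> y \<Longrightarrow> T x y \<le> T x' y"
  using nonneg[of "x' - x" y] by (simp add: diff_left)

lemma mono_right: "y \<le> y' \<Longrightarrow> 0 \<le> x \<Longrightarrow> T x y \<le> T x y'"
  using nonneg[of x "y' - y"] by (simp add: diff_right)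

lemma mono: "x \<le> x' \<Longrightarrow> y \<le> y' \<Longrightarrow> 0 \<le> x \<Longrightarrow> 0 \<le> y \<Longrightarrow> T x y \<le> T x' y'"
  by (meson mono_left mono_right order_trans)

text \<open>By \<open>two_inf_eq\<close> twice the infimum involves only sums and one absolute
  value, and \<open>rabs_eq\<close> carries the latter through \<open>T\<close> because
  \<open>y\<close> is its own absolute value.\<close>

lemma inf_left:
  assumes "0 \<le> y"
  shows "T (inf a b) y = inf (T a y) (T b y)"
proof -
  have "2 *\<^sub>R T (inf a b) y = T (a + b - rabs (a - b)) y"
    by (simp add: two_inf_eq flip: scaleR_left)
  also have "\<dots> = T a y + T b y - rabs (T a y - T b y)"
    using rabs_eq[of "a - b" y] assms by (simp add: diff_left add_left rabs_of_nonneg)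
  also have "\<dots> = 2 *\<^sub>R inf (T a y) (T b y)"
    by (simp add: two_inf_eq)
  finally show ?thesis by simp
qed

lemma disjoint_left:
  assumes "inf a b = 0" "0 \<le> a" "0 \<le> b" "0 \<le> y" "0 \<le> y'"
  shows "inf (T a y) (T b y') = 0"
proof -
  \<comment> \<open>Enlarging both second factors to the common \<open>y + y'\<close> makes
    \<open>inf_left\<close> applicable.\<close>
  have "inf (T a (y + y')) (T b (y + y')) = 0"
    using inf_left[of "y + y'" a b] assms by simp
  then show ?thesis
    by (rule disjoint_mono) (use assms in \<open>auto intro!: nonneg mono_right\<close>)
qed

text \<open>The excess of \<open>T a y\<close> over \<open>T b y\<close> lies below
  \<open>T (pos_part (a - b)) y\<close>, which is disjoint from \<open>T p q\<close> because the
  left factors are disjoint.\<close>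

lemma le_on_left:
  assumes "le_on p a b" "0 \<le> p" "0 \<le> q" "0 \<le> y"
  shows "le_on (T p q) (T a y) (T b y)"
proof -
  have "inf (T (pos_part (a - b)) y) (T p q) = 0"
    using assms by (intro disjoint_left) (auto simp: le_on_def)
  moreover have "T a y - T b y \<le> T (pos_part (a - b)) y"
    using assms mono_left[of "a - b" "pos_part (a - b)" y] by (simp add: diff_left)
  ultimately show ?thesis
    unfolding le_on_def using assms by (elim disjoint_mono) (auto intro!: nonneg)
qed

lemmas disjoint_right = riesz_bimorphism.disjoint_left[OF flip]
lemmas le_on_right = riesz_bimorphism.le_on_left[OF flip]

text \<open>The complement of \<open>T p q\<close> splits as
  \<open>T (e - p) f + T p (f - q)\<close>, and each summand is disjoint from \<open>T p q\<close>
  through one of its factors.\<close>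

lemma component_tensor:
  assumes e: "p \<in> components e" and f: "q \<in> components f"
  shows "T p q \<in> components (T e f)"
proof -
  have p: "0 \<le> p" "p \<le> e" "inf (e - p) p = 0" and q: "0 \<le> q" "q \<le> f" "inf (f - q) q = 0"
    using assms by (auto simp: components_def)
  have "inf (T (e - p) f + T p (f - q)) (T p q) = 0"
    using p q by (intro disjoint_add disjoint_left disjoint_right nonneg) auto
  moreover have "T (e - p) f + T p (f - q) = T e f - T p q"
    by (simp add: diff_left diff_right)
  ultimately show ?thesis
    using p q by (auto simp: components_def intro: nonneg mono)
qed

section \<open>Localising tensors\<close>

text \<open>The pieces on which $x \ge m_1 x_1$ and $x \le m_2 x_1$ overlap because $m_1 < m_2$,
  so one of them still meets \<open>r\<close>.\<close>

lemma split_localisation: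
  assumes m: "m1 < m2" and p: "0 \<le> p" "p \<le> x1" and "0 \<le> q" "0 \<le> r"
    and ne: "inf (T p q) r \<noteq> 0"
  shows "inf (T (inf p (pos_part (x - m1 *\<^sub>R x1))) q) r \<noteq> 0
    \<or> inf (T (inf p (pos_part (m2 *\<^sub>R x1 - x))) q) r \<noteq> 0"
proof (rule ccontr)
  assume neg: "\<not> ?thesis"
  define A where "A = pos_part (x - m1 *\<^sub>R x1)"
  define B where "B = pos_part (m2 *\<^sub>R x1 - x)"
  \<comment> \<open>The bound \<open>1 / (m2 - m1)\<close> yields
    \<open>x1 \<le> C *\<^sub>R (A + B)\<close>; the bound 1 yields
    \<open>p \<le> C *\<^sub>R p\<close>, so that \<open>C\<close> can be pulled out of the infima
    with \<open>p\<close>.\<close>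
  define C where "C = max 1 (1 / (m2 - m1))"
  have AB: "0 \<le> A" "0 \<le> B" by (simp_all add: A_def B_def)
  have C: "1 \<le> C" "1 / (m2 - m1) \<le> C" by (simp_all add: C_def)
  have "(m2 - m1) *\<^sub>R x1 \<le> A + B"
    using add_mono[of "x - m1 *\<^sub>R x1" A "m2 *\<^sub>R x1 - x" B]
    by (simp add: A_def B_def scaleR_diff_left)
  then have "(1 / (m2 - m1)) *\<^sub>R ((m2 - m1) *\<^sub>R x1) \<le> (1 / (m2 - m1)) *\<^sub>R (A + B)"
    using m by (intro scaleR_left_mono) auto
  also have "\<dots> \<le> C *\<^sub>R (A + B)"
    using AB C by (intro scaleR_right_mono) auto
  finally have "p \<le> C *\<^sub>R A + C *\<^sub>R B"
    using m p by (simp add: scaleR_add_right)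
  then have "p = inf p (C *\<^sub>R A + C *\<^sub>R B)" by (simp add: inf_absorb1)
  also have "\<dots> \<le> inf p (C *\<^sub>R A) + inf p (C *\<^sub>R B)"
    using p AB C by (intro inf_add_le scaleR_nonneg_nonneg) auto
  also have "\<dots> \<le> C *\<^sub>R inf p A + C *\<^sub>R inf p B"
    using p scaleR_right_mono[of 1 C p] C
    by (intro add_mono) (auto simp: scaleR_inf intro: le_infI1)
  finally have "T p q \<le> T (C *\<^sub>R inf p A + C *\<^sub>R inf p B) q"
    using assms by (intro mono_left)
  then have le: "T p q \<le> C *\<^sub>R T (inf p A) q + C *\<^sub>R T (inf p B) q"
    by (simp add: add_left scaleR_left)
  have "inf (C *\<^sub>R T (inf p A) q + C *\<^sub>R T (inf p B) q) r = 0"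
    using neg p AB C assms
    by (intro disjoint_add disjoint_scaleR scaleR_nonneg_nonneg nonneg) (auto simp: A_def B_def)
  then have "inf (T p q) r = 0"
    by (rule disjoint_mono) (use assms le in \<open>auto intro: nonneg\<close>)
  with ne show False by simp
qed

text \<open>The interval starts as [-1, 1] because \<open>rabs x \<le> x1\<close>. Each round keeps
  one of its overlapping two-thirds, [lo, m2] or [m1, hi], on which the piece still meets
  \<open>r\<close>. The overlap matters: with a single cut point both positive parts could
  vanish.\<close>

lemma localise_interval:
  assumes p: "0 \<le> p" "p \<le> x1" and x: "rabs x \<le> x1" and "0 \<le> q" "0 \<le> r"
    and ne: "inf (T p q) r \<noteq> 0"
  shows "\<exists>p' lo hi. 0 \<le> p' \<and> p' \<le> p \<and> inf (T p' q) r \<noteq> 0 \<and> - 1 \<le> lo \<and> lo \<le> hi \<and> hi \<le> (1::real)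
    \<and> hi - lo = 2 * (2 / 3) ^ n \<and> le_on p' x (hi *\<^sub>R x1) \<and> le_on p' (lo *\<^sub>R x1) x"
proof (induction n)
  case 0
  have "le_on p x (1 *\<^sub>R x1)" "le_on p ((- 1) *\<^sub>R x1) x"
    using p x rabs_ge[of x] by (auto intro!: le_on_if_le simp: minus_le_iff intro: order_trans)
  then show ?case using p ne by (intro exI[of _ p] exI[of _ "-1"] exI[of _ 1]) auto
next
  case (Suc n)
  then obtain p' lo hi where *: "0 \<le> p'" "p' \<le> p" "inf (T p' q) r \<noteq> 0" "- 1 \<le> lo" "lo \<le> hi" "hi \<le> 1"
    and len: "hi - lo = 2 * (2 / 3) ^ n" and on: "le_on p' x (hi *\<^sub>R x1)" "le_on p' (lo *\<^sub>R x1) x"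
    by blast
  define m1 where "m1 = lo + (hi - lo) / 3"
  define m2 where "m2 = hi - (hi - lo) / 3"
  have "0 < hi - lo" by (simp add: len)
  then have m: "m1 < m2" "lo < m1" "m2 < hi" by (simp_all add: m1_def m2_def field_simps)
  have len': "hi - m1 = 2 * (2 / 3) ^ Suc n" "m2 - lo = 2 * (2 / 3) ^ Suc n"
    using len by (simp_all add: m1_def m2_def field_simps)
  have "p' \<le> x1" using * p by simp
  from split_localisation[OF m(1) *(1) this assms(4,5) *(3), of x]
  show ?case
  proof
    let ?p = "inf p' (pos_part (x - m1 *\<^sub>R x1))"
    assume "inf (T ?p q) r \<noteq> 0"
    moreover have "le_on ?p x (hi *\<^sub>R x1)"
      using on(1) by (rule le_on_mono) (use * in auto)
    moreover have "le_on ?p (m1 *\<^sub>R x1) x"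
      by (rule le_on_mono[OF le_on_pos_part]) (use * in auto)
    ultimately show ?thesis
      using * m len' by (intro exI[of _ ?p] exI[of _ m1] exI[of _ hi]) (auto intro: le_infI1)
  next
    let ?p = "inf p' (pos_part (m2 *\<^sub>R x1 - x))"
    assume "inf (T ?p q) r \<noteq> 0"
    moreover have "le_on ?p (lo *\<^sub>R x1) x"
      using on(2) by (rule le_on_mono) (use * in auto)
    moreover have "le_on ?p x (m2 *\<^sub>R x1)"
      by (rule le_on_mono[OF le_on_pos_part]) (use * in auto)
    ultimately show ?thesis
      using * m len' by (intro exI[of _ ?p] exI[of _ lo] exI[of _ m2]) (auto intro: le_infI1)
  qed
qed

text \<open>Once the interval is shorter than \<delta>, its lower end serves as \<alpha>: on the
  piece, \<open>x - lo *\<^sub>R x1\<close> lies between 0 and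
  \<open>(hi - lo) *\<^sub>R x1\<close>.\<close>

lemma localise_left:
  assumes p: "0 \<le> p" "p \<le> x1" and x: "rabs x \<le> x1" and "0 \<le> q" "0 \<le> r"
    and ne: "inf (T p q) r \<noteq> 0" and \<delta>: "0 < (\<delta>::real)"
  shows "\<exists>p' \<alpha>. 0 \<le> p' \<and> p' \<le> p \<and> inf (T p' q) r \<noteq> 0 \<and> \<bar>\<alpha>\<bar> \<le> 1
    \<and> le_on p' (rabs (x - \<alpha> *\<^sub>R x1)) (\<delta> *\<^sub>R x1)"
proof -
  obtain n where n: "(2 / 3) ^ n < \<delta> / 2"
    using real_arch_pow_inv[of "\<delta> / 2" "2 / 3"] \<delta> by auto
  obtain p' lo hi where *: "0 \<le> p'" "p' \<le> p" "inf (T p' q) r \<noteq> 0" "- 1 \<le> lo" "lo \<le> hi" "hi \<le> 1"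
    and len: "hi - lo = 2 * (2 / 3) ^ n" and on: "le_on p' x (hi *\<^sub>R x1)" "le_on p' (lo *\<^sub>R x1) x"
    using localise_interval[OF assms(1-6), of n] by blast
  have x1: "0 \<le> x1" using p by simp
  have "le_on p' (x - lo *\<^sub>R x1) ((hi - lo) *\<^sub>R x1)"
    using on(1) by (rule le_on_cong_diff) (simp add: scaleR_diff_left)
  moreover have "le_on p' (- (x - lo *\<^sub>R x1)) 0"
    using on(2) by (rule le_on_cong_diff) simp
  moreover have "0 \<le> (hi - lo) *\<^sub>R x1" using * x1 by (intro scaleR_nonneg_nonneg) auto
  ultimately have "le_on p' (rabs (x - lo *\<^sub>R x1)) ((hi - lo) *\<^sub>R x1)"
    unfolding rabs_def using * by (meson le_on_sup le_on_trans le_on_if_le)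
  moreover have "(hi - lo) *\<^sub>R x1 \<le> \<delta> *\<^sub>R x1"
    using n len x1 by (intro scaleR_right_mono) auto
  ultimately have "le_on p' (rabs (x - lo *\<^sub>R x1)) (\<delta> *\<^sub>R x1)"
    using * by (meson le_on_trans le_on_if_le)
  with * show ?thesis by (intro exI[of _ p'] exI[of _ lo]) auto
qed

lemmas localise_right = riesz_bimorphism.localise_left[OF flip]

text \<open>Localise \<open>x\<close> first, then \<open>y\<close> on what remains, and take
  \<gamma> = \<alpha> \<beta>. The error is \<open>T (x - \<alpha> *\<^sub>R x1) y + \<alpha>
  *\<^sub>R T x1 (y - \<beta> *\<^sub>R y1)\<close>; as \<open>rabs y \<le> y1\<close> and
  |\<alpha>| \<le> 1, each term costs at most \<eta>/2 times \<open>T x1 y1\<close>.\<close>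

lemma localise_tensor:
  assumes p: "0 \<le> p" "p \<le> x1" and q: "0 \<le> q" "q \<le> y1" and x: "rabs x \<le> x1" and y: "rabs y \<le> y1"
    and r: "0 \<le> r" and ne: "inf (T p q) r \<noteq> 0" and \<eta>: "0 < (\<eta>::real)"
  shows "\<exists>p' q' \<gamma>. 0 \<le> p' \<and> p' \<le> p \<and> 0 \<le> q' \<and> q' \<le> q \<and> inf (T p' q') r \<noteq> 0
    \<and> le_on (T p' q') (rabs (T x y - \<gamma> *\<^sub>R T x1 y1)) (\<eta> *\<^sub>R T x1 y1)"
proof -
  have xy1: "0 \<le> x1" "0 \<le> y1" using p q by simp_all
  obtain p' \<alpha> where p': "0 \<le> p'" "p' \<le> p" "inf (T p' q) r \<noteq> 0" "\<bar>\<alpha>\<bar> \<le> 1"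
    and on1: "le_on p' (rabs (x - \<alpha> *\<^sub>R x1)) ((\<eta> / 2) *\<^sub>R x1)"
    using localise_left[of p x1 x q r "\<eta> / 2"] assms by auto
  obtain q' \<beta> where q': "0 \<le> q'" "q' \<le> q" "inf (T p' q') r \<noteq> 0"
    and on2: "le_on q' (rabs (y - \<beta> *\<^sub>R y1)) ((\<eta> / 2) *\<^sub>R y1)"
    using localise_right[of q y1 y p' r "\<eta> / 2"] assms p' by auto
  let ?d = "T p' q'" and ?U = "T x1 y1"
  let ?a = "x - \<alpha> *\<^sub>R x1" and ?b = "y - \<beta> *\<^sub>R y1"
  have d: "0 \<le> ?d" using p' q' nonneg by auto
  have "le_on ?d (T (rabs ?a) y1) (T ((\<eta> / 2) *\<^sub>R x1) y1)"
    using on1 p' q' xy1 by (intro le_on_left)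
  moreover have "le_on ?d (T x1 (rabs ?b)) (T x1 ((\<eta> / 2) *\<^sub>R y1))"
    using on2 p' q' xy1 by (intro le_on_right)
  ultimately have "le_on ?d (T (rabs ?a) y1 + T x1 (rabs ?b)) ((\<eta> / 2) *\<^sub>R ?U + (\<eta> / 2) *\<^sub>R ?U)"
    using d le_on_add by (fastforce simp: scaleR_left scaleR_right)
  then have on: "le_on ?d (T (rabs ?a) y1 + T x1 (rabs ?b)) (\<eta> *\<^sub>R ?U)"
    by (simp flip: scaleR_add_left)
  have eq: "T x y - (\<alpha> * \<beta>) *\<^sub>R ?U = T ?a y + \<alpha> *\<^sub>R T x1 ?b"
    by (simp add: diff_left diff_right scaleR_left scaleR_right scaleR_diff_right)
  have "rabs (T ?a y) \<le> T (rabs ?a) y1"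
    using y by (simp add: rabs_eq mono_right rabs_nonneg)
  moreover have "rabs (\<alpha> *\<^sub>R T x1 ?b) \<le> T x1 (rabs ?b)"
    using p'(4) xy1 scaleR_right_mono[of "\<bar>\<alpha>\<bar>" 1 "T x1 (rabs ?b)"]
    by (simp add: rabs_scaleR rabs_eq rabs_of_nonneg nonneg rabs_nonneg)
  ultimately have "rabs (T x y - (\<alpha> * \<beta>) *\<^sub>R ?U) \<le> T (rabs ?a) y1 + T x1 (rabs ?b)"
    unfolding eq by (meson add_mono order_trans rabs_triangle)
  then have "le_on ?d (rabs (T x y - (\<alpha> * \<beta>) *\<^sub>R ?U)) (\<eta> *\<^sub>R ?U)"
    using on d by (meson le_on_trans le_on_if_le)
  then show ?thesis using p' q' by blast
qed

section \<open>Elements that are locally almost constant multiples of a tensor\<close>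

text \<open>Allowing all larger \<open>x1\<close>, \<open>y1\<close> lets several elements be
  compared with the same tensor; allowing all \<open>p\<close>, \<open>q\<close> and
  \<open>r\<close> lets localisations be nested.\<close>

definition localisable_from :: "'c \<Rightarrow> 'a \<Rightarrow> 'b \<Rightarrow> bool" where
  "localisable_from z x0 y0 \<longleftrightarrow> (\<forall>x1 y1 p q r \<eta>. x0 \<le> x1 \<longrightarrow> y0 \<le> y1 \<longrightarrow>
    0 \<le> p \<longrightarrow> p \<le> x1 \<longrightarrow> 0 \<le> q \<longrightarrow> q \<le> y1 \<longrightarrow> 0 \<le> r \<longrightarrow> inf (T p q) r \<noteq> 0 \<longrightarrow> 0 < \<eta> \<longrightarrow>
    (\<exists>p' q' \<gamma>. 0 \<le> p' \<and> p' \<le> p \<and> 0 \<le> q' \<and> q' \<le> q \<and> inf (T p' q') r \<noteq> 0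
      \<and> le_on (T p' q') (rabs (z - \<gamma> *\<^sub>R T x1 y1)) (\<eta> *\<^sub>R T x1 y1)))"

definition localisable :: "'c \<Rightarrow> bool" where
  "localisable z \<longleftrightarrow> (\<exists>x0 y0. 0 \<le> x0 \<and> 0 \<le> y0 \<and> localisable_from z x0 y0)"

lemma localisable_fromD:
  assumes "localisable_from z x0 y0" "x0 \<le> x1" "y0 \<le> y1" "0 \<le> p" "p \<le> x1" "0 \<le> q" "q \<le> y1" "0 \<le> r"
    "inf (T p q) r \<noteq> 0" "0 < \<eta>"
  shows "\<exists>p' q' \<gamma>. 0 \<le> p' \<and> p' \<le> p \<and> 0 \<le> q' \<and> q' \<le> q \<and> inf (T p' q') r \<noteq> 0
    \<and> le_on (T p' q') (rabs (z - \<gamma> *\<^sub>R T x1 y1)) (\<eta> *\<^sub>R T x1 y1)"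
  using assms unfolding localisable_from_def by blast

lemma localisable_tensor: "localisable (T x y)"
  unfolding localisable_def localisable_from_def
  by (intro exI[of _ "rabs x"] exI[of _ "rabs y"] conjI allI impI rabs_nonneg localise_tensor)

text \<open>Adding the thresholds provides a common \<open>T x1 y1\<close>. Localising for
  \<open>z\<close> and then for \<open>z'\<close> inside the piece found makes both estimates hold
  on one tensor; accuracy \<eta>/C absorbs the loss in \<open>comb\<close>.\<close>

lemma localisable_combine:
  assumes "localisable z" "localisable z'" and C: "0 < (C::real)"
    and comb: "\<And>d \<gamma> \<gamma>' \<eta> U. 0 \<le> d \<Longrightarrow> 0 \<le> U \<Longrightarrow> 0 < \<eta> \<Longrightarrow> le_on d (rabs (z - \<gamma> *\<^sub>R U)) (\<eta> *\<^sub>R U) \<Longrightarrow>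
      le_on d (rabs (z' - \<gamma>' *\<^sub>R U)) (\<eta> *\<^sub>R U) \<Longrightarrow>
      \<exists>\<gamma>''. le_on d (rabs (w - \<gamma>'' *\<^sub>R U)) ((C * \<eta>) *\<^sub>R U)"
  shows "localisable w"
proof -
  obtain x0 y0 x0' y0' where xy0: "0 \<le> x0" "0 \<le> y0" "0 \<le> x0'" "0 \<le> y0'"
    and z: "localisable_from z x0 y0" and z': "localisable_from z' x0' y0'"
    using assms(1,2) by (auto simp: localisable_def)
  have "localisable_from w (x0 + x0') (y0 + y0')"
    unfolding localisable_from_def
  proof (intro allI impI)
    fix x1 y1 p q r and \<eta> :: real
    assume xy1: "x0 + x0' \<le> x1" "y0 + y0' \<le> y1"
      and p: "0 \<le> p" "p \<le> x1" and q: "0 \<le> q" "q \<le> y1" and r: "0 \<le> r"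
      and ne: "inf (T p q) r \<noteq> 0" and \<eta>: "0 < \<eta>"
    have le: "x0 \<le> x1" "x0' \<le> x1" "y0 \<le> y1" "y0' \<le> y1"
      using xy0 xy1 by (meson add_increasing add_increasing2 order_refl order_trans)+
    let ?U = "T x1 y1"
    have U: "0 \<le> ?U" using p q by (intro nonneg) auto
    have \<eta>': "0 < \<eta> / C" using \<eta> C by simp
    obtain p' q' \<gamma> where p': "0 \<le> p'" "p' \<le> p" and q': "0 \<le> q'" "q' \<le> q"
      and ne': "inf (T p' q') r \<noteq> 0"
      and on: "le_on (T p' q') (rabs (z - \<gamma> *\<^sub>R ?U)) ((\<eta> / C) *\<^sub>R ?U)"
      using localisable_fromD[OF z le(1,3) p q r ne \<eta>'] by blast
    obtain p'' q'' \<gamma>' where p'': "0 \<le> p''" "p'' \<le> p'" and q'': "0 \<le> q''" "q'' \<le> q'"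
      and ne'': "inf (T p'' q'') r \<noteq> 0"
      and on': "le_on (T p'' q'') (rabs (z' - \<gamma>' *\<^sub>R ?U)) ((\<eta> / C) *\<^sub>R ?U)"
      using localisable_fromD[OF z' le(2,4) p'(1) order_trans[OF p'(2) p(2)] q'(1)
          order_trans[OF q'(2) q(2)] r ne' \<eta>'] by blast
    have d: "0 \<le> T p'' q''" "T p'' q'' \<le> T p' q'"
      using p'' q'' by (auto intro: nonneg mono)
    have "le_on (T p'' q'') (rabs (z - \<gamma> *\<^sub>R ?U)) ((\<eta> / C) *\<^sub>R ?U)"
      using on d by (rule le_on_mono)
    from comb[OF d(1) U \<eta>' this on']
    have "\<exists>\<gamma>''. le_on (T p'' q'') (rabs (w - \<gamma>'' *\<^sub>R ?U)) (\<eta> *\<^sub>R ?U)"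
      using C by simp
    then show "\<exists>p' q' \<gamma>. 0 \<le> p' \<and> p' \<le> p \<and> 0 \<le> q' \<and> q' \<le> q \<and> inf (T p' q') r \<noteq> 0
        \<and> le_on (T p' q') (rabs (w - \<gamma> *\<^sub>R ?U)) (\<eta> *\<^sub>R ?U)"
      using p'' q'' p' q' ne'' by (meson order_trans)
  qed
  with xy0 show ?thesis
    unfolding localisable_def by (intro exI[of _ "x0 + x0'"] exI[of _ "y0 + y0'"]) simp
qed

lemma localisable_add:
  assumes "localisable z" "localisable z'"
  shows "localisable (z + z')"
proof (rule localisable_combine[OF assms, of 2])
  fix d U :: 'c and \<gamma> \<gamma>' \<eta> :: real
  assume d: "0 \<le> d" and on: "le_on d (rabs (z - \<gamma> *\<^sub>R U)) (\<eta> *\<^sub>R U)" "le_on d (rabs (z' - \<gamma>' *\<^sub>R U)) (\<eta> *\<^sub>R U)"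
  have "z + z' - (\<gamma> + \<gamma>') *\<^sub>R U = (z - \<gamma> *\<^sub>R U) + (z' - \<gamma>' *\<^sub>R U)"
    by (simp add: scaleR_add_left)
  then have "rabs (z + z' - (\<gamma> + \<gamma>') *\<^sub>R U) \<le> rabs (z - \<gamma> *\<^sub>R U) + rabs (z' - \<gamma>' *\<^sub>R U)"
    by (metis rabs_triangle)
  moreover have "le_on d (rabs (z - \<gamma> *\<^sub>R U) + rabs (z' - \<gamma>' *\<^sub>R U)) ((2 * \<eta>) *\<^sub>R U)"
    using le_on_add[OF on d] by (simp flip: scaleR_add_left)
  ultimately show "\<exists>\<gamma>''. le_on d (rabs (z + z' - \<gamma>'' *\<^sub>R U)) ((2 * \<eta>) *\<^sub>R U)"
    using d by (meson le_on_if_le le_on_trans)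
qed simp

lemma localisable_scaleR:
  assumes "localisable z"
  shows "localisable (c *\<^sub>R z)"
\<comment> \<open>The added 1 keeps the factor positive when \<open>c = 0\<close>.\<close>
proof (rule localisable_combine[OF assms assms, of "\<bar>c\<bar> + 1"])
  fix d U :: 'c and \<gamma> \<eta> :: real
  assume d: "0 \<le> d" and U: "0 \<le> U" and \<eta>: "0 < \<eta>" and on: "le_on d (rabs (z - \<gamma> *\<^sub>R U)) (\<eta> *\<^sub>R U)"
  have "rabs (c *\<^sub>R z - (c * \<gamma>) *\<^sub>R U) = \<bar>c\<bar> *\<^sub>R rabs (z - \<gamma> *\<^sub>R U)"
    by (simp add: scaleR_diff_right flip: rabs_scaleR)
  moreover have "le_on d (\<bar>c\<bar> *\<^sub>R rabs (z - \<gamma> *\<^sub>R U)) (\<bar>c\<bar> *\<^sub>R (\<eta> *\<^sub>R U))"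
    using on d by (intro le_on_scaleR) auto
  moreover have "\<bar>c\<bar> *\<^sub>R (\<eta> *\<^sub>R U) \<le> ((\<bar>c\<bar> + 1) * \<eta>) *\<^sub>R U"
    using scaleR_right_mono[of "\<bar>c\<bar> * \<eta>" "(\<bar>c\<bar> + 1) * \<eta>" U] U \<eta> by simp
  ultimately have "le_on d (rabs (c *\<^sub>R z - (c * \<gamma>) *\<^sub>R U)) (((\<bar>c\<bar> + 1) * \<eta>) *\<^sub>R U)"
    using d by (metis le_on_if_le le_on_trans)
  then show "\<exists>\<gamma>''. le_on d (rabs (c *\<^sub>R z - \<gamma>'' *\<^sub>R U)) (((\<bar>c\<bar> + 1) * \<eta>) *\<^sub>R U)" by blast
qed simp

lemma localisable_sup:
  assumes "localisable z" "localisable z'"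
  shows "localisable (sup z z')"
proof (rule localisable_combine[OF assms, of 1])
  fix d U :: 'c and \<gamma> \<gamma>' \<eta> :: real
  assume d: "0 \<le> d" and U: "0 \<le> U"
    and on: "le_on d (rabs (z - \<gamma> *\<^sub>R U)) (\<eta> *\<^sub>R U)" "le_on d (rabs (z' - \<gamma>' *\<^sub>R U)) (\<eta> *\<^sub>R U)"
  let ?m = "max \<gamma> \<gamma>'" and ?s = "sup (rabs (z - \<gamma> *\<^sub>R U)) (rabs (z' - \<gamma>' *\<^sub>R U))"
  have m: "\<gamma> *\<^sub>R U \<le> ?m *\<^sub>R U" "\<gamma>' *\<^sub>R U \<le> ?m *\<^sub>R U"
    using U by (auto intro: scaleR_right_mono)
  have s: "z - \<gamma> *\<^sub>R U \<le> ?s" "z' - \<gamma>' *\<^sub>R U \<le> ?s" "- (z - \<gamma> *\<^sub>R U) \<le> ?s" "- (z' - \<gamma>' *\<^sub>R U) \<le> ?s"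
    using rabs_ge by (meson le_supI1 le_supI2)+
  have "z \<le> ?s + ?m *\<^sub>R U" "z' \<le> ?s + ?m *\<^sub>R U"
    using add_mono[OF s(1) m(1)] add_mono[OF s(2) m(2)] by simp_all
  then have "sup z z' - ?m *\<^sub>R U \<le> ?s" by (simp only: diff_le_eq le_sup_iff)
  moreover have "- (sup z z' - ?m *\<^sub>R U) \<le> ?s"
  proof -
    \<comment> \<open>The element whose constant attains the maximum already gives this
      bound.\<close>
    have "?m *\<^sub>R U \<le> ?s + sup z z'"
    proof (cases "\<gamma> \<le> \<gamma>'")
      case True
      have "?m *\<^sub>R U = - (z' - \<gamma>' *\<^sub>R U) + z'" using True by (simp add: max_def)
      also have "\<dots> \<le> ?s + sup z z'" by (intro add_mono s) simp
      finally show ?thesis .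
    next
      case False
      have "?m *\<^sub>R U = - (z - \<gamma> *\<^sub>R U) + z" using False by (simp add: max_def)
      also have "\<dots> \<le> ?s + sup z z'" by (intro add_mono s) simp
      finally show ?thesis .
    qed
    then show ?thesis by (simp only: minus_diff_eq diff_le_eq)
  qed
  ultimately have "rabs (sup z z' - ?m *\<^sub>R U) \<le> ?s" by (simp only: rabs_def[of "sup z z' - _"] le_sup_iff)
  moreover have "le_on d ?s ((1 * \<eta>) *\<^sub>R U)"
    using le_on_sup[OF on d] by simp
  ultimately show "\<exists>\<gamma>''. le_on d (rabs (sup z z' - \<gamma>'' *\<^sub>R U)) ((1 * \<eta>) *\<^sub>R U)"
    using d by (meson le_on_if_le le_on_trans)
qed simp

end

text \<open>If $x' \otimes y = 0$ with $x' = x \wedge e$, then $x \otimes y$ is disjoint from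
  $e \otimes y$, and comparing \<open>f\<close> with multiples of \<open>y\<close> forces
  $x \otimes y \le \frac1n\, x \otimes f$ for all \<open>n\<close>.\<close>

lemma (in riesz_bimorphism) inf_left_tensor_nonzero:
  assumes arch: "\<And>z u :: 'c. (\<And>t::real. 0 < t \<Longrightarrow> z \<le> t *\<^sub>R u) \<Longrightarrow> z \<le> 0"
    and x: "0 \<le> x" and y: "0 \<le> y" and e: "0 \<le> e" and f: "0 \<le> f"
    and le: "T x y \<le> T e f" and ne: "T x y \<noteq> 0"
  shows "T (inf x e) y \<noteq> 0"
proof
  assume "T (inf x e) y = 0"
  then have disj: "inf (T x y) (T e y) = 0" using y by (simp add: inf_left)
  have z: "0 \<le> T x y" using x y by (rule nonneg)
  have "T x y \<le> t *\<^sub>R T x f" if t: "0 < t" for t :: real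
  proof -
    define s where "s = 1 / t"
    have s: "0 < s" "t * s = 1" using t by (simp_all add: s_def)
    \<comment> \<open>Up to the disjoint excesses \<open>f'\<close> and \<open>y'\<close>,
      \<open>f\<close> and \<open>s *\<^sub>R y\<close> agree. In
      \<open>f \<le> f' + s *\<^sub>R y\<close> the second term contributes a multiple of
      \<open>T e y\<close>, disjoint from \<open>T x y\<close>, so only \<open>T e f'\<close>
      remains as a bound.\<close>
    define f' where "f' = pos_part (f - s *\<^sub>R y)"
    define y' where "y' = pos_part (s *\<^sub>R y - f)"
    have fy: "0 \<le> f'" "0 \<le> y'" "inf y' f' = 0"
      by (simp_all add: f'_def y'_def disjoint_pos_part_minus)
    have "f \<le> f' + s *\<^sub>R y" using riesz.add_sup_distrib_right[of "f - s *\<^sub>R y" 0 "s *\<^sub>R y"]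
      by (simp add: f'_def)
    then have "T e f \<le> T e f' + s *\<^sub>R T e y"
      using mono_right[of f "f' + s *\<^sub>R y" e] e by (simp add: add_right scaleR_right)
    then have "T x y \<le> T e f' + s *\<^sub>R T e y" using le by simp
    moreover have "inf (T x y) (s *\<^sub>R T e y) = 0"
      using disj s z nonneg[OF e y] disjoint_scaleR[of "T e y" "T x y" s] by (simp add: inf_commute)
    ultimately have z_le: "T x y \<le> T e f'"
      using z s e y fy by (elim le_of_le_add_disjoint) (auto intro!: nonneg scaleR_nonneg_nonneg)
    have "s *\<^sub>R y \<le> f + y'" using riesz.add_sup_distrib_right[of "s *\<^sub>R y - f" 0 f]
      by (simp add: y'_def add.commute)
    then have "t *\<^sub>R (s *\<^sub>R y) \<le> t *\<^sub>R (f + y')" using t by (intro scaleR_left_mono) auto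
    then have "T x y \<le> t *\<^sub>R T x f + t *\<^sub>R T x y'"
      using s mono_right[of y "t *\<^sub>R (f + y')" x] x
      by (simp add: add_right scaleR_right scaleR_add_right)
    \<comment> \<open>Since \<open>T x y \<le> T e f'\<close> and \<open>y'\<close> is disjoint from
      \<open>f'\<close>, the excess term in \<open>y'\<close> drops out as well.\<close>
    moreover have "inf (T x y) (t *\<^sub>R T x y') = 0"
    proof -
      have "inf (T x y') (T e f') = 0"
        using x e fy by (intro disjoint_right)
      then have "inf (T x y') (T x y) = 0"
        using z z_le x fy by (elim disjoint_mono) (auto intro: nonneg)
      then show ?thesis
        using t z x fy disjoint_scaleR[of "T x y'" "T x y" t] by (simp add: nonneg inf_commute)
    qed
    ultimately show ?thesis
      using z t x f fy by (elim le_of_le_add_disjoint) (auto intro!: nonneg scaleR_nonneg_nonneg)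
  qed
  then have "T x y \<le> 0" by (rule arch)
  with z ne show False by simp
qed

section \<open>Components below a positive element\<close>

text \<open>The component is the band projection of \<open>e\<close> onto the band of
  \<open>v = pos_part (x - \<alpha> *\<^sub>R e)\<close>, built as the supremum of the truncated
  multiples \<open>inf (real n *\<^sub>R v) e\<close>.\<close>

lemma component_below:
  fixes x e :: "'a::{ordered_real_vector, conditionally_complete_lattice}"
  assumes x: "0 \<le> x" "x \<le> e" and \<alpha>: "0 < (\<alpha>::real)"
  shows "\<exists>p\<in>components e. \<alpha> *\<^sub>R p \<le> x \<and> x \<le> \<alpha> *\<^sub>R e + p"
proof -
  define v where "v = pos_part (x - \<alpha> *\<^sub>R e)"
  define a where "a = (\<lambda>n::nat. inf (real n *\<^sub>R v) e)"
  define p where "p = Sup (range a)"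
  have e: "0 \<le> e" using x by simp
  have v: "0 \<le> v" by (simp add: v_def)
  have "\<alpha> *\<^sub>R e \<ge> 0" using e \<alpha> by (intro scaleR_nonneg_nonneg) auto
  then have "x - \<alpha> *\<^sub>R e \<le> e" using x by (metis add_increasing2 diff_le_eq)
  then have ve: "v \<le> e" using e by (simp add: v_def)
  have a: "0 \<le> a n" "a n \<le> e" for n
    using v e by (auto simp: a_def intro!: scaleR_nonneg_nonneg)
  then have bdd: "bdd_above (range a)" by (auto intro!: bdd_aboveI)
  have a_le: "a n \<le> p" for n
    unfolding p_def using bdd by (intro cSup_upper rangeI)
  have least: "p \<le> b" if "\<And>n. a n \<le> b" for b
    unfolding p_def using that by (intro cSup_least) auto
  have p: "0 \<le> p" "p \<le> e" using a a_le[of 0] least[of e] by (auto intro: order_trans)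
  have disjoint_a: "inf (a n) c = 0" if "inf v c = 0" "0 \<le> c" for c n
    using disjoint_scaleR[OF that(1) v that(2), of "real n"]
    by (rule disjoint_mono) (use a that in \<open>simp_all add: a_def\<close>)
  have "inf (e - p) v = 0"
  proof -
    define t where "t = inf (e - p) v"
    \<comment> \<open>Adding \<open>t\<close> stays below both (n+1) \<open>v\<close> and
      \<open>e\<close>, hence below \<open>a (Suc n)\<close>; so \<open>p - t\<close> is again an
      upper bound.\<close>
    have "a n \<le> p - t" for n
    proof -
      have "a n + t \<le> real n *\<^sub>R v + v"
        unfolding a_def t_def by (intro add_mono inf_le1 inf_le2)
      moreover have "a n + t \<le> p + (e - p)"
        unfolding t_def by (intro add_mono a_le inf_le1)
      ultimately have "a n + t \<le> a (Suc n)"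
        by (simp add: a_def scaleR_add_left add.commute)
      then show ?thesis using a_le[of "Suc n"] by (metis le_diff_eq order_trans)
    qed
    then have "p \<le> p - t" by (rule least)
    then have "t \<le> 0" by simp
    moreover have "0 \<le> t" using p v by (simp add: t_def)
    ultimately have "t = 0" by (rule antisym)
    then show ?thesis by (simp add: t_def)
  qed
  then have disj: "inf (a n) (e - p) = 0" for n
    using disjoint_a[of "e - p"] p by (simp add: inf_commute)
  \<comment> \<open>Each \<open>a n\<close> is disjoint from \<open>m\<close>, so their sum is their
    supremum and stays below \<open>p\<close>; thus \<open>p - m\<close> is an upper bound too,
    forcing \<open>m = 0\<close>.\<close>
  define m where "m = inf (e - p) p"
  have m: "0 \<le> m" "m \<le> e - p" "m \<le> p" using p by (simp_all add: m_def)
  have "a n \<le> p - m" for n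
  proof -
    have "inf (a n) m = 0" using disj[of n] by (rule disjoint_mono) (use a m in auto)
    then have "a n + m = sup (a n) m" using riesz.add_eq_inf_sup[of "a n" m] by simp
    also have "\<dots> \<le> p" using a_le m by simp
    finally show ?thesis by (simp add: le_diff_eq)
  qed
  then have "p \<le> p - m" by (rule least)
  then have "m = 0" using m by simp
  then have "p \<in> components e" using p by (simp add: components_def m_def)
  moreover have "\<alpha> *\<^sub>R p \<le> x"
  proof -
    have "a n \<le> inverse \<alpha> *\<^sub>R x" for n
    proof -
      \<comment> \<open>The shortfall of \<open>x\<close> below \<open>\<alpha> *\<^sub>R e\<close>
        is disjoint from \<open>v\<close>, hence from every \<open>a n\<close>, and cancels from the
        bound \<open>x + c\<close>.\<close>
      define c where "c = pos_part (\<alpha> *\<^sub>R e - x)"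
      have c: "0 \<le> c" "inf v c = 0" by (simp_all add: c_def v_def disjoint_pos_part_minus)
      have "\<alpha> *\<^sub>R e \<le> x + c" using riesz.add_sup_distrib_left[of x "\<alpha> *\<^sub>R e - x" 0]
        by (simp add: c_def)
      moreover have "\<alpha> *\<^sub>R a n \<le> \<alpha> *\<^sub>R e" using a \<alpha> by (intro scaleR_left_mono) auto
      ultimately have "\<alpha> *\<^sub>R a n \<le> x + c" by simp
      moreover have "inf (\<alpha> *\<^sub>R a n) c = 0"
        using disjoint_a[OF c(2,1)] a c \<alpha> by (intro disjoint_scaleR) auto
      ultimately have "\<alpha> *\<^sub>R a n \<le> x"
        using a \<alpha> x c by (elim le_of_le_add_disjoint) (auto intro!: scaleR_nonneg_nonneg)
      then have "inverse \<alpha> *\<^sub>R \<alpha> *\<^sub>R a n \<le> inverse \<alpha> *\<^sub>R x"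
        using \<alpha> by (intro scaleR_left_mono) auto
      then show ?thesis using \<alpha> by simp
    qed
    then have "p \<le> inverse \<alpha> *\<^sub>R x" by (rule least)
    then have "\<alpha> *\<^sub>R p \<le> \<alpha> *\<^sub>R (inverse \<alpha> *\<^sub>R x)" using \<alpha> by (intro scaleR_left_mono) auto
    then show ?thesis using \<alpha> by simp
  qed
  moreover have "x \<le> \<alpha> *\<^sub>R e + p"
  proof -
    \<comment> \<open>As \<open>v \<le> e\<close>, the first multiple is not truncated.\<close>
    have "v = a 1" using ve by (simp add: a_def inf_absorb1)
    then have "x - \<alpha> *\<^sub>R e \<le> p" using a_le[of 1] by (metis v_def le_sup_iff)
    then show ?thesis by (simp add: diff_le_eq add.commute)
  qed
  ultimately show ?thesis by blast
qed

text \<open>If every such \<open>T p y\<close> vanished, \<open>component_below\<close> would give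
  \<open>T (inf x e) y \<le> \<alpha> *\<^sub>R T e y\<close> for all \<alpha> > 0, so
  \<open>T (inf x e) y\<close> would be 0, against \<open>inf_left_tensor_nonzero\<close>.\<close>

lemma component_tensor_nonzero_left:
  fixes T :: "'a::{ordered_real_vector, conditionally_complete_lattice} \<Rightarrow>
      'b::{ordered_real_vector, lattice} \<Rightarrow> 'c::{ordered_real_vector, conditionally_complete_lattice}"
  assumes "riesz_bimorphism T" and x: "0 \<le> x" and y: "0 \<le> y" and e: "0 \<le> e" and f: "0 \<le> f"
    and le: "T x y \<le> T e f" and ne: "T x y \<noteq> 0"
  shows "\<exists>p\<in>components e. \<exists>\<alpha>>0. \<alpha> *\<^sub>R p \<le> x \<and> T p y \<noteq> 0"
proof (rule ccontr)
  assume neg: "\<not> ?thesis"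
  interpret riesz_bimorphism T by fact
  let ?x = "inf x e"
  have "T ?x y \<le> \<alpha> *\<^sub>R T e y" if \<alpha>: "0 < \<alpha>" for \<alpha> :: real
  proof -
    obtain p where p: "p \<in> components e" "\<alpha> *\<^sub>R p \<le> ?x" "?x \<le> \<alpha> *\<^sub>R e + p"
      using component_below[of ?x e \<alpha>] x e \<alpha> by auto
    then have "T p y = 0" using neg \<alpha> by auto
    then show ?thesis using mono_left[OF p(3) y] by (simp add: add_left scaleR_left)
  qed
  then have "T ?x y \<le> 0" by (rule archimedean)
  moreover have "T ?x y \<noteq> 0"
    by (rule inf_left_tensor_nonzero[OF archimedean x y e f le ne])
  moreover have "0 \<le> T ?x y" using x y e by (intro nonneg) auto
  ultimately show False by simp
qed

text \<open>Replace \<open>x\<close> by a multiple of a component, then apply the flipped result to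
  \<open>y\<close> with that multiple as the other factor; the constant is \<alpha> \<beta>.\<close>

lemma component_tensor_below:
  fixes T :: "'a::{ordered_real_vector, conditionally_complete_lattice} \<Rightarrow>
      'b::{ordered_real_vector, conditionally_complete_lattice} \<Rightarrow>
      'c::{ordered_real_vector, conditionally_complete_lattice}"
  assumes T: "riesz_bimorphism T" and x: "0 \<le> x" and y: "0 \<le> y" and e: "0 \<le> e" and f: "0 \<le> f"
    and le: "T x y \<le> T e f" and ne: "T x y \<noteq> 0"
  shows "\<exists>p\<in>components e. \<exists>q\<in>components f. \<exists>c>0. c *\<^sub>R T p q \<le> T x y \<and> T p q \<noteq> 0"
proof -
  interpret riesz_bimorphism T by fact
  obtain p \<alpha> where p: "p \<in> components e" and \<alpha>: "0 < \<alpha>" "\<alpha> *\<^sub>R p \<le> x" and pn: "T p y \<noteq> 0"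
    using component_tensor_nonzero_left[OF assms] by blast
  have p0: "0 \<le> p" using p by (simp add: components_def)
  have ap: "0 \<le> \<alpha> *\<^sub>R p" using p0 \<alpha> by (intro scaleR_nonneg_nonneg) auto
  have le': "T (\<alpha> *\<^sub>R p) y \<le> T x y" using \<alpha> y by (intro mono_left)
  have "T (\<alpha> *\<^sub>R p) y \<noteq> 0" using pn \<alpha> by (simp add: scaleR_left)
  then obtain q \<beta> where q: "q \<in> components f" and \<beta>: "0 < \<beta>" "\<beta> *\<^sub>R q \<le> y"
    and qn: "T (\<alpha> *\<^sub>R p) q \<noteq> 0"
    using component_tensor_nonzero_left[OF flip y ap f e order_trans[OF le' le]] by blast
  have "(\<alpha> * \<beta>) *\<^sub>R T p q = T (\<alpha> *\<^sub>R p) (\<beta> *\<^sub>R q)"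
    by (simp add: scaleR_left scaleR_right)
  also have "\<dots> \<le> T (\<alpha> *\<^sub>R p) y" using \<beta> ap by (intro mono_right)
  finally have "(\<alpha> * \<beta>) *\<^sub>R T p q \<le> T x y" using le' by simp
  moreover have "T p q \<noteq> 0" using qn by (auto simp: scaleR_left)
  ultimately show ?thesis using p q \<alpha> \<beta> by (meson mult_pos_pos)
qed

section \<open>The Fremlin tensor product\<close>

lemma fvl_diff: "g \<in> fvl \<Longrightarrow> h \<in> fvl \<Longrightarrow> (\<lambda>\<omega>. g \<omega> - h \<omega>) \<in> fvl"
  using fvl_add[of g "\<lambda>\<omega>. - 1 * h \<omega>"] fvl_scale[of h "- 1"] by simp

locale fremlin =
  fixes J :: "(('a::{ordered_real_vector, lattice} \<times> 'b::{ordered_real_vector, lattice} \<Rightarrow> real) \<Rightarrow> real)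
    \<Rightarrow> 'c::{ordered_real_vector, conditionally_complete_lattice}"
  assumes completion: "fremlin_completion J"
begin

abbreviation tensor (infixl "\<otimes>" 70) where "x \<otimes> y \<equiv> J (ev (x, y))"

lemma J_add: "g \<in> fvl \<Longrightarrow> h \<in> fvl \<Longrightarrow> J (\<lambda>\<omega>. g \<omega> + h \<omega>) = J g + J h"
  and J_scale: "g \<in> fvl \<Longrightarrow> J (\<lambda>\<omega>. c * g \<omega>) = c *\<^sub>R J g"
  and J_max: "g \<in> fvl \<Longrightarrow> h \<in> fvl \<Longrightarrow> J (\<lambda>\<omega>. max (g \<omega>) (h \<omega>)) = sup (J g) (J h)"
  and J_kernel: "{g \<in> fvl. J g = 0} = tensor_kernel"
  and J_is_sup: "is_sup z {J g | g. g \<in> fvl \<and> J g \<le> z}"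
  using completion by (auto simp: fremlin_completion_def)

lemma J_diff: "g \<in> fvl \<Longrightarrow> h \<in> fvl \<Longrightarrow> J (\<lambda>\<omega>. g \<omega> - h \<omega>) = J g - J h"
  using J_add[of g "\<lambda>\<omega>. - 1 * h \<omega>"] J_scale[of h "- 1"] fvl_scale[of h "- 1"] by simp

text \<open>The kernel is an intersection of ideals that all contain the relations.\<close>

lemma J_relation: "g \<in> tensor_relations \<Longrightarrow> J g = 0"
  using J_kernel by (auto simp: tensor_kernel_def)

lemma bimorphism: "riesz_bimorphism (\<lambda>x y. x \<otimes> y)"
proof
  fix x x' :: 'a and y y' :: 'b and c :: real
  note [intro] = fvl_ev fvl_diff fvl_scale fvl_max
  have "J (\<lambda>\<omega>. ev (x + x', y) \<omega> - ev (x, y) \<omega> - ev (x', y) \<omega>) = 0"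
    by (rule J_relation) (unfold tensor_relations_def Un_iff mem_Collect_eq, blast)
  then show "(x + x') \<otimes> y = x \<otimes> y + x' \<otimes> y"
    by (subst (asm) J_diff, blast, blast, subst (asm) J_diff, blast, blast) (simp add: algebra_simps)
  have "J (\<lambda>\<omega>. ev (x, y + y') \<omega> - ev (x, y) \<omega> - ev (x, y') \<omega>) = 0"
    by (rule J_relation) (unfold tensor_relations_def Un_iff mem_Collect_eq, blast)
  then show "x \<otimes> (y + y') = x \<otimes> y + x \<otimes> y'"
    by (subst (asm) J_diff, blast, blast, subst (asm) J_diff, blast, blast) (simp add: algebra_simps)
  have "J (\<lambda>\<omega>. ev (c *\<^sub>R x, y) \<omega> - c * ev (x, y) \<omega>) = 0"
    by (rule J_relation) (unfold tensor_relations_def Un_iff mem_Collect_eq, blast)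
  then show "(c *\<^sub>R x) \<otimes> y = c *\<^sub>R (x \<otimes> y)"
    by (subst (asm) J_diff, blast, blast, subst (asm) J_scale, blast) simp
  have "J (\<lambda>\<omega>. ev (x, c *\<^sub>R y) \<omega> - c * ev (x, y) \<omega>) = 0"
    by (rule J_relation) (unfold tensor_relations_def Un_iff mem_Collect_eq, blast)
  then show "x \<otimes> (c *\<^sub>R y) = c *\<^sub>R (x \<otimes> y)"
    by (subst (asm) J_diff, blast, blast, subst (asm) J_scale, blast) simp
  have "J (\<lambda>\<omega>. \<bar>ev (x, y) \<omega>\<bar> - ev (rabs x, rabs y) \<omega>) = 0"
    by (rule J_relation) (unfold tensor_relations_def Un_iff mem_Collect_eq, blast)
  \<comment> \<open>\<open>J\<close> is only known to respect maxima, so the absolute value is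
    rewritten as one.\<close>
  moreover have "\<bar>ev (x, y) \<omega>\<bar> = max (ev (x, y) \<omega>) (- 1 * ev (x, y) \<omega>)" for \<omega>
    by auto
  ultimately have "J (\<lambda>\<omega>. max (ev (x, y) \<omega>) (- 1 * ev (x, y) \<omega>) - ev (rabs x, rabs y) \<omega>) = 0"
    by (simp only:)
  moreover have "J (\<lambda>\<omega>. max (ev (x, y) \<omega>) (- 1 * ev (x, y) \<omega>) - ev (rabs x, rabs y) \<omega>)
      = sup (x \<otimes> y) ((- 1) *\<^sub>R (x \<otimes> y)) - rabs x \<otimes> rabs y"
    using J_diff[OF fvl_max[OF fvl_ev fvl_scale[OF fvl_ev]] fvl_ev] J_max[OF fvl_ev fvl_scale[OF fvl_ev]]
      J_scale[OF fvl_ev] by (simp only:)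
  ultimately show "rabs (x \<otimes> y) = rabs x \<otimes> rabs y"
    by (simp add: rabs_def)
qed

sublocale riesz_bimorphism "\<lambda>x y. x \<otimes> y" by (rule bimorphism)

text \<open>Tensors are localisable, and each operation generating \<open>fvl\<close> preserves
  this.\<close>

lemma localisable_fvl: "g \<in> fvl \<Longrightarrow> localisable (J g)"
proof (induction rule: fvl.induct)
  case (fvl_ev s)
  show ?case by (cases s) (simp add: localisable_tensor)
next
  case (fvl_add g h)
  show ?case unfolding J_add[OF fvl_add.hyps] by (rule localisable_add[OF fvl_add.IH])
next
  case (fvl_scale g c)
  show ?case unfolding J_scale[OF fvl_scale.hyps] by (rule localisable_scaleR[OF fvl_scale.IH])
next
  case (fvl_max g h)
  show ?case unfolding J_max[OF fvl_max.hyps] by (rule localisable_sup[OF fvl_max.IH])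
qed

text \<open>Localise $(z - \varepsilon U)^+$, where $U = (x_0 + e) \otimes (y_0 + f)$: there \<open>z\<close> is
  within $\varepsilon/4$ of a constant multiple of \<open>U\<close>, which has to be large.\<close>

lemma tensor_below:
  assumes g: "g \<in> fvl" and e: "0 \<le> e" and f: "0 \<le> f"
    and le: "J g \<le> e \<otimes> f" and ne: "\<not> J g \<le> 0"
  shows "\<exists>x\<ge>0. \<exists>y\<ge>0. x \<otimes> y \<noteq> 0 \<and> x \<otimes> y \<le> pos_part (J g)"
proof -
  obtain x0 y0 where xy0: "0 \<le> x0" "0 \<le> y0" and loc: "localisable_from (J g) x0 y0"
    using localisable_fvl[OF g] by (auto simp: localisable_def)
  \<comment> \<open>Adding \<open>e\<close> and \<open>f\<close> to the thresholds makes
    \<open>U\<close> dominate \<open>e \<otimes> f\<close>, hence \<open>J g\<close>.\<close>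
  define x1 where "x1 = x0 + e"
  define y1 where "y1 = y0 + f"
  define U where "U = x1 \<otimes> y1"
  have x1: "0 \<le> x1" "x0 \<le> x1" "e \<le> x1" and y1: "0 \<le> y1" "y0 \<le> y1" "f \<le> y1"
    using xy0 e f by (auto simp: x1_def y1_def)
  have U: "0 \<le> U" "J g \<le> U"
    using x1 y1 e f le mono[of e x1 f y1] by (auto simp: U_def intro!: nonneg)
  obtain \<epsilon> :: real where \<epsilon>: "0 < \<epsilon>" "\<not> J g \<le> \<epsilon> *\<^sub>R U"
    using archimedean[of "J g" U] ne by blast
  define r where "r = pos_part (J g - \<epsilon> *\<^sub>R U)"
  have r0: "0 \<le> r" by (simp add: r_def)
  have "r \<noteq> 0"
  proof
    assume "r = 0"
    then have "J g - \<epsilon> *\<^sub>R U \<le> 0" by (metis r_def sup_ge1)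
    then show False using \<epsilon>(2) by simp
  qed
  have "0 \<le> \<epsilon> *\<^sub>R U" using \<epsilon> U by (intro scaleR_nonneg_nonneg) auto
  then have "J g - \<epsilon> *\<^sub>R U \<le> U" using U(2) by (metis add_increasing2 diff_le_eq)
  then have "r \<le> U" using U by (simp add: r_def)
  then have "inf (x1 \<otimes> y1) r \<noteq> 0" using \<open>r \<noteq> 0\<close> by (simp add: U_def inf_absorb2)
  moreover have "0 < \<epsilon> / 4" using \<epsilon> by simp
  ultimately obtain p q \<gamma> where p: "0 \<le> p" "p \<le> x1" and q: "0 \<le> q" "q \<le> y1"
    and meets: "inf (p \<otimes> q) r \<noteq> 0"
    and on: "le_on (p \<otimes> q) (rabs (J g - \<gamma> *\<^sub>R U)) ((\<epsilon> / 4) *\<^sub>R U)"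
    using localisable_fromD[OF loc x1(2) y1(2) x1(1) order_refl y1(1) order_refl r0]
    unfolding U_def by blast
  let ?d = "p \<otimes> q"
  have d: "0 \<le> ?d" "?d \<le> U" using p q by (auto simp: U_def intro: nonneg mono)
  \<comment> \<open>Otherwise \<open>J g \<le> \<epsilon> *\<^sub>R U\<close> would hold on the band
    of \<open>?d\<close>, making \<open>?d\<close> disjoint from \<open>r\<close>.\<close>
  have "\<epsilon> \<le> \<gamma> + \<epsilon> / 4"
  proof (rule ccontr)
    assume "\<not> ?thesis"
    then have "(\<gamma> + \<epsilon> / 4) *\<^sub>R U \<le> \<epsilon> *\<^sub>R U" using U by (intro scaleR_right_mono) auto
    moreover have "le_on ?d (J g - \<gamma> *\<^sub>R U) ((\<epsilon> / 4) *\<^sub>R U)"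
      using on d rabs_ge(1) by (meson le_on_if_le le_on_trans)
    then have "le_on ?d (J g) ((\<gamma> + \<epsilon> / 4) *\<^sub>R U)"
      by (rule le_on_cong_diff) (simp add: scaleR_add_left)
    ultimately have "le_on ?d (J g) (\<epsilon> *\<^sub>R U)"
      using d by (meson le_on_if_le le_on_trans)
    then show False using meets by (simp add: le_on_def r_def inf_commute)
  qed
  then have "(\<epsilon> / 2) *\<^sub>R U \<le> (\<gamma> - \<epsilon> / 4) *\<^sub>R U" using U by (intro scaleR_right_mono) auto
  moreover have "le_on ?d (- (J g - \<gamma> *\<^sub>R U)) ((\<epsilon> / 4) *\<^sub>R U)"
    using on d rabs_ge(2) by (meson le_on_if_le le_on_trans)
  then have "le_on ?d ((\<gamma> - \<epsilon> / 4) *\<^sub>R U) (J g)"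
    by (rule le_on_cong_diff) (simp add: scaleR_diff_left)
  ultimately have "le_on ?d ((\<epsilon> / 2) *\<^sub>R U) (J g)"
    using d by (meson le_on_if_le le_on_trans)
  then have disj: "inf ?d (pos_part ((\<epsilon> / 2) *\<^sub>R U - J g)) = 0"
    by (simp add: le_on_def inf_commute)
  \<comment> \<open>On the band of \<open>?d\<close>, \<open>J g\<close> dominates
    \<open>(\<epsilon> / 2) *\<^sub>R U\<close>; the possible deficit elsewhere is disjoint from
    \<open>?t\<close> and cancels.\<close>
  let ?t = "(\<epsilon> / 2) *\<^sub>R ?d"
  have t0: "0 \<le> ?t" using d \<epsilon> by (intro scaleR_nonneg_nonneg) auto
  have "?t \<le> (\<epsilon> / 2) *\<^sub>R U" using d \<epsilon> by (intro scaleR_left_mono) auto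
  also have "\<dots> \<le> pos_part (J g) + pos_part ((\<epsilon> / 2) *\<^sub>R U - J g)"
    using add_mono[of "J g" "pos_part (J g)" "(\<epsilon> / 2) *\<^sub>R U - J g"] by simp
  finally have "?t \<le> pos_part (J g)"
    by (rule le_of_le_add_disjoint) (use disj d \<epsilon> t0 in \<open>auto intro!: disjoint_scaleR\<close>)
  moreover have "?t = ((\<epsilon> / 2) *\<^sub>R p) \<otimes> q" by (simp add: scaleR_left)
  moreover have "?t \<noteq> 0" using meets \<epsilon> r0 by (auto simp: inf_absorb1)
  moreover have "0 \<le> (\<epsilon> / 2) *\<^sub>R p" using p \<epsilon> by (intro scaleR_nonneg_nonneg) auto
  ultimately show ?thesis using q by metis
qed

text \<open>Since \<open>w\<close> is the supremum of the image elements below it, one of these is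
  not \<le> 0, and \<open>tensor_below\<close> applies to it.\<close>

lemma tensor_below_completion:
  assumes w: "0 \<le> w" "w \<noteq> 0" "w \<le> e \<otimes> f" and e: "0 \<le> e" and f: "0 \<le> f"
  shows "\<exists>x\<ge>0. \<exists>y\<ge>0. x \<otimes> y \<noteq> 0 \<and> x \<otimes> y \<le> w"
proof -
  have "\<exists>g\<in>fvl. J g \<le> w \<and> \<not> J g \<le> 0"
  proof (rule ccontr)
    assume "\<not> ?thesis"
    then have "w \<le> 0" using J_is_sup[of w] by (auto simp: is_sup_def)
    with w show False by simp
  qed
  then obtain g where g: "g \<in> fvl" "J g \<le> w" "\<not> J g \<le> 0" by blast
  then have "pos_part (J g) \<le> w" using w by simp
  then show ?thesis using tensor_below[OF g(1) e f _ g(3)] g(2) w by (meson order_trans)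
qed

end

section \<open>Components of the tensor product\<close>

text \<open>A multiple of \<open>t\<close> below \<open>u\<close> is disjoint from
  \<open>w - u\<close>, hence so is \<open>t\<close>; that summand then cancels from
  \<open>t \<le> u + (w - u)\<close>.\<close>

lemma le_component_of_scaleR_le:
  fixes t u w :: "'a::{ordered_real_vector, lattice}"
  assumes u: "u \<in> components w" and t: "0 \<le> t" "t \<le> w" and c: "0 < c" "c *\<^sub>R t \<le> u"
  shows "t \<le> u"
proof -
  have u': "0 \<le> u" "u \<le> w" "inf u (w - u) = 0"
    using u by (auto simp: components_def inf_commute)
  have ct: "0 \<le> c *\<^sub>R t" using t c by (intro scaleR_nonneg_nonneg) auto
  have "inf (c *\<^sub>R t) (w - u) = 0"
    using u'(3) by (rule disjoint_mono) (use c ct u' in auto)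
  then have "inf (inverse c *\<^sub>R (c *\<^sub>R t)) (w - u) = 0"
    by (rule disjoint_scaleR) (use ct u' c in auto)
  then have "inf t (w - u) = 0" using c by simp
  then show ?thesis
    using t u' by (intro le_of_le_add_disjoint[of t u "w - u"]) auto
qed

theorem theorem3p1:
  fixes e :: "'a::{ordered_real_vector, conditionally_complete_lattice}"
    and f :: "'b::{ordered_real_vector, conditionally_complete_lattice}"
    and J :: "(('a \<times> 'b \<Rightarrow> real) \<Rightarrow> real) \<Rightarrow> 'c::{ordered_real_vector, conditionally_complete_lattice}"
  assumes "weak_order_unit e" and "weak_order_unit f"
    and "fremlin_completion J"
  shows "(\<forall>p q. p \<in> components e \<and> q \<in> components f
            \<longrightarrow> J (ev (p, q)) \<in> components (J (ev (e, f))))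
       \<and> (\<forall>u. u \<in> components (J (ev (e, f))) \<longrightarrow>
            is_sup u {J (ev (p, q)) | p q. p \<in> components e \<and> q \<in> components f
                                           \<and> J (ev (p, q)) \<le> u})"
proof (intro conjI allI impI)
  interpret fremlin J by unfold_locales fact
  have e: "0 \<le> e" and f: "0 \<le> f" using assms by (simp_all add: weak_order_unit_def)
  show "J (ev (p, q)) \<in> components (J (ev (e, f)))" if "p \<in> components e \<and> q \<in> components f" for p q
    using that component_tensor by blast
  fix u
  assume u: "u \<in> components (J (ev (e, f)))"
  then have u0: "0 \<le> u" "u \<le> J (ev (e, f))" by (simp_all add: components_def)
  let ?S = "{J (ev (p, q)) | p q. p \<in> components e \<and> q \<in> components f \<and> J (ev (p, q)) \<le> u}"
  show "is_sup u ?S"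
    unfolding is_sup_def
  proof (intro conjI allI impI)
    fix b
    assume ub: "\<forall>s\<in>?S. s \<le> b"
    have zero: "0 \<in> components e" "0 \<in> components f"
      using e f by (simp_all add: components_def inf_absorb2)
    \<comment> \<open>The zero tensor forces \<open>b\<close> to be nonnegative, which is what gives
      \<open>w \<le> u\<close> below.\<close>
    then have "J (ev (0, 0)) \<in> ?S" using u0 by (auto intro!: exI[of _ 0])
    then have b: "0 \<le> b" using ub by fastforce
    show "u \<le> b"
    proof (rule ccontr)
      assume "\<not> u \<le> b"
      define w where "w = u - inf u b"
      have w: "0 \<le> w" "w \<noteq> 0" "w \<le> u"
        using \<open>\<not> u \<le> b\<close> u0 b by (auto simp: w_def inf.order_iff[of u b] simp del: riesz.diff_inf_eq_sup)
      then obtain x y where xy: "0 \<le> x" "0 \<le> y" "J (ev (x, y)) \<noteq> 0" "J (ev (x, y)) \<le> w"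
        using tensor_below_completion[OF w(1,2) order_trans[OF w(3) u0(2)] e f] by blast
      then obtain p q c where p: "p \<in> components e" and q: "q \<in> components f"
        and c: "0 < c" "c *\<^sub>R J (ev (p, q)) \<le> J (ev (x, y))" and ne: "J (ev (p, q)) \<noteq> 0"
        using component_tensor_below[OF bimorphism xy(1,2) e f _ xy(3)]
          order_trans[OF xy(4) order_trans[OF w(3) u0(2)]] by blast
      define t where "t = J (ev (p, q))"
      have t: "0 \<le> t" "t \<le> J (ev (e, f))" "inf (J (ev (e, f)) - t) t = 0"
        using component_tensor[OF p q] by (simp_all add: components_def t_def)
      have ctw: "c *\<^sub>R t \<le> w" using c xy by (simp add: t_def)
      then have tu: "t \<le> u"
        using le_component_of_scaleR_le[OF u t(1,2) c(1)] w by simp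
      then have "t \<le> b" using ub p q by (auto simp: t_def)
      \<comment> \<open>As \<open>t\<close> lies below both \<open>u\<close> and \<open>b\<close>,
        it lies below \<open>inf u b\<close>, so \<open>w \<le> u - t\<close>.\<close>
      then have "c *\<^sub>R t \<le> u - t"
        using ctw tu unfolding w_def by (metis diff_left_mono inf_greatest order_trans)
      then have "c *\<^sub>R t \<le> J (ev (e, f)) - t" using u0 by (meson diff_right_mono order_trans)
      moreover have "0 \<le> c *\<^sub>R t" using c t by (intro scaleR_nonneg_nonneg) auto
      \<comment> \<open>\<open>t\<close> is disjoint from its complement in
        \<open>e \<otimes> f\<close>, which contains a positive multiple of \<open>t\<close>; so
        \<open>t\<close> is disjoint from itself.\<close>
      ultimately have "inf (c *\<^sub>R t) t = 0"
        using t by (elim disjoint_mono) auto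
      then have "inf (inverse c *\<^sub>R (c *\<^sub>R t)) t = 0"
        by (rule disjoint_scaleR) (use t c \<open>0 \<le> c *\<^sub>R t\<close> in auto)
      then have "t = 0" using c by simp
      then show False using ne by (simp add: t_def)
    qed
  qed auto
qed

end
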